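(* Let $n$ be a nonnegative integer. If $n$ is MC, then every MC-circle $M_n$ of $n$ is a lattice circle.
   Context: A lattice point is a point of the $xy$-plane with integer coordinates. A circle is the 1-dimensional boundary of a disk of positive radius. A circle encloses a point if the point lies in the open disk bounded by the circle (points on the circumference are not enclosed). For a nonnegative integer $n$, a circle (with arbitrary real center) is $n$-enclosing if it encloses exactly $n$ lattice points. A nonnegative integer $n$ is MC (maximally circlable) if among all $n$-enclosing circles there is one of largest radius. Let $\Delta$ be the closed triangle (interior and boundary) with vertices $(1/2,0)$, $(1/2,1/2)$, $(1,0)$. An MC-circle of an MC number $n$ is an $n$-enclosing circle of largest radius whose center lies in $\Delta$ (every $n$-enclosing circle of largest radius can be moved to such a one by an isometry preserving the integer lattice). A lattice circle is a circle with at least three lattice points on its circumference. *)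

theory Defs
  imports "HOL-Analysis.Analysis"
begin

text \<open>
  The plane is \<^typ>\<open>real \<times> real\<close>, whose library metric is the Euclidean one. A circle is given
  by its center \<open>c\<close> and its radius \<open>r > 0\<close>: the circle is \<open>sphere c r\<close>, and the open disk it
  bounds is \<open>ball c r\<close>. Both contain only finitely many lattice points, so \<open>card\<close> counts them.
\<close>

definition lattice_points :: "(real \<times> real) set" where
  "lattice_points = \<int> \<times> \<int>"

definition n_enclosing :: "nat \<Rightarrow> real \<times> real \<Rightarrow> real \<Rightarrow> bool" where
  "n_enclosing n c r \<longleftrightarrow> r > 0 \<and> card (lattice_points \<inter> ball c r) = n"

definition largest_n_enclosing :: "nat \<Rightarrow> real \<times> real \<Rightarrow> real \<Rightarrow> bool" where
  "largest_n_enclosing n c r \<longleftrightarrow>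
     n_enclosing n c r \<and> (\<forall>c' r'. n_enclosing n c' r' \<longrightarrow> r' \<le> r)"

definition MC :: "nat \<Rightarrow> bool" where
  "MC n \<longleftrightarrow> (\<exists>c r. largest_n_enclosing n c r)"

definition Delta :: "(real \<times> real) set" where
  "Delta = convex hull {(1/2, 0), (1/2, 1/2), (1, 0)}"

definition MC_circle :: "nat \<Rightarrow> real \<times> real \<Rightarrow> real \<Rightarrow> bool" where
  "MC_circle n c r \<longleftrightarrow> largest_n_enclosing n c r \<and> c \<in> Delta"

definition lattice_circle :: "real \<times> real \<Rightarrow> real \<Rightarrow> bool" where
  "lattice_circle c r \<longleftrightarrow> r > 0 \<and> card (lattice_points \<inter> sphere c r) \<ge> 3"

end

theory Submission
  imports Defs
begin

text \<open>
  If at most two lattice points lie on a circle, let its center move away from them along the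
  perpendicular bisector of these two points, with the radius adjusted so that the circle still
  passes through them. The radius grows, and for a small displacement no lattice point enters
  or leaves the open disk, so the circle was not a largest one.
\<close>

lemma finite_lattice_points_cball: "finite (lattice_points \<inter> cball c R)"
proof (rule finite_subset)
  let ?I = "\<lambda>a. {k :: real. k \<in> \<int> \<and> a - R \<le> k \<and> k \<le> a + R}"
  show "lattice_points \<inter> cball c R \<subseteq> ?I (fst c) \<times> ?I (snd c)"
  proof
    fix x assume x: "x \<in> lattice_points \<inter> cball c R"
    then have "\<bar>fst c - fst x\<bar> \<le> R" "\<bar>snd c - snd x\<bar> \<le> R"
      using dist_fst_le[of c x] dist_snd_le[of c x] by (simp_all add: dist_real_def)
    with x show "x \<in> ?I (fst c) \<times> ?I (snd c)"
      by (simp add: lattice_points_def mem_Times_iff abs_le_iff)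
  qed
  show "finite (?I (fst c) \<times> ?I (snd c))"
    using finite_int_segment by blast
qed

text \<open>The two points may coincide or lie outside \<open>A\<close>, so circles through zero,
  one or two lattice points can be handled uniformly.\<close>

lemma card_le_2_subset_pair:
  assumes "finite A" "card A \<le> 2"
  obtains p q where "A \<subseteq> {p, q}"
proof -
  consider "card A = 0" | "card A = 1" | "card A = 2"
    using assms(2) by linarith
  then show thesis
    using assms(1) that by cases (auto simp: card_1_singleton_iff card_2_iff)
qed

text \<open>A quarter turn of \<open>p - q\<close> is orthogonal to it (if \<open>p = q\<close>, any
  vector is), and passing to the negative if necessary fixes the sign. The sign means that a center
  moving from \<open>c\<close> along \<open>v\<close> does not approach \<open>p\<close> and
  \<open>q\<close>.\<close>

lemma exists_bisector_direction:
  fixes c p q :: "real \<times> real"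
  obtains v where "v \<noteq> 0" "v \<bullet> (p - c) = v \<bullet> (q - c)" "v \<bullet> (p - c) \<le> 0"
proof -
  obtain w :: "real \<times> real" where w: "w \<noteq> 0" "w \<bullet> (p - q) = 0"
  proof (cases "p = q")
    case True
    then show thesis using that[of "(1, 0)"] by (simp add: zero_prod_def)
  next
    case False
    then show thesis
      using that[of "(snd (p - q), - fst (p - q))"]
      by (auto simp: inner_prod_def zero_prod_def prod_eq_iff algebra_simps)
  qed
  then have eq: "w \<bullet> (p - c) = w \<bullet> (q - c)"
    by (simp add: inner_diff_right)
  show thesis
  proof (cases "w \<bullet> (p - c) \<le> 0")
    case True
    then show thesis using that[of w] w eq by blast
  next
    case False
    then show thesis using that[of "- w"] w eq by simp
  qed
qed

lemma exists_larger_enclosing_circle: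
  fixes c p q :: "real \<times> real"
  assumes "r > 0" and on: "lattice_points \<inter> sphere c r \<subseteq> {p, q}"
  obtains c' r' where "r' > r" "lattice_points \<inter> ball c' r' = lattice_points \<inter> ball c r"
proof -
  obtain v where v: "v \<noteq> 0" "v \<bullet> (p - c) = v \<bullet> (q - c)" "v \<bullet> (p - c) \<le> 0"
    using exists_bisector_direction .
  define K where "K = - (v \<bullet> (p - c))"
  \<comment> \<open>If \<open>p\<close> or \<open>q\<close> lies on the original circle,
    \<open>\<rho> t\<close> is its distance from the moved center \<open>c + t *\<^sub>R v\<close>,
    for t \<ge> 0.\<close>
  define \<rho> where "\<rho> t = sqrt (r\<^sup>2 + t\<^sup>2 * (norm v)\<^sup>2 + 2 * t * K)" for t
  \<comment> \<open>This is the power of \<open>x\<close> with respect to the circle about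
    \<open>c + t *\<^sub>R v\<close> of radius \<open>\<rho> t\<close>. The terms quadratic in
    \<open>t\<close> cancel, so it is affine in \<open>t\<close>; at \<open>p\<close> and
    \<open>q\<close> it is constant by the choice of \<open>K\<close>.\<close>
  define f where "f x t = (dist c x)\<^sup>2 - r\<^sup>2 - 2 * t * (v \<bullet> (x - c) + K)" for x t
  have K: "K \<ge> 0" "v \<bullet> (p - c) + K = 0" "v \<bullet> (q - c) + K = 0"
    using v by (simp_all add: K_def)
  have \<rho>_gr: "\<rho> t > r" if "t > 0" for t
  proof -
    \<comment> \<open>The quadratic term makes this strict even when \<open>K = 0\<close>, as
      happens when \<open>p\<close> and \<open>q\<close> are the ends of a diameter.\<close>
    have "r\<^sup>2 < r\<^sup>2 + t\<^sup>2 * (norm v)\<^sup>2 + 2 * t * K"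
      using that v(1) K(1) by (simp add: add_pos_nonneg)
    then show ?thesis
      unfolding \<rho>_def by (rule real_less_rsqrt)
  qed
  have ball_iff: "x \<in> ball (c + t *\<^sub>R v) (\<rho> t) \<longleftrightarrow> f x t < 0" if "t > 0" for x t
  proof -
    have "\<rho> t > 0"
      using \<rho>_gr[OF that] \<open>r > 0\<close> by linarith
    then have "x \<in> ball (c + t *\<^sub>R v) (\<rho> t) \<longleftrightarrow> (dist (c + t *\<^sub>R v) x)\<^sup>2 < (\<rho> t)\<^sup>2"
      by (simp add: abs_less_iff flip: abs_le_square_iff not_le)
    also have "(dist (c + t *\<^sub>R v) x)\<^sup>2 = (dist c x)\<^sup>2 + t\<^sup>2 * (norm v)\<^sup>2 - 2 * t * (v \<bullet> (x - c))"
      unfolding dist_norm power2_norm_eq_inner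
      by (simp add: inner_simps inner_commute algebra_simps power2_eq_square)
    also have "(\<rho> t)\<^sup>2 = r\<^sup>2 + t\<^sup>2 * (norm v)\<^sup>2 + 2 * t * K"
      unfolding \<rho>_def using that K(1) by simp
    finally show ?thesis
      by (simp add: f_def algebra_simps)
  qed
  have ball0_iff: "x \<in> ball c r \<longleftrightarrow> f x 0 < 0" for x
    using \<open>r > 0\<close> by (simp add: f_def abs_less_iff flip: abs_le_square_iff not_le)
  \<comment> \<open>By the triangle inequality this disk contains the original open disk and all the
    moved ones with 0 < t < 1. Hence only finitely many points have to be watched, and one small
    \<open>t\<close> serves them all.\<close>
  define F where "F = lattice_points \<inter> cball c (norm v + \<rho> 1)"
  have sign: "\<forall>\<^sub>F t in at_right 0. f x t < 0 \<longleftrightarrow> f x 0 < 0" if "x \<in> F" for x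
  proof -
    have lim: "(f x \<longlongrightarrow> f x 0) (at_right 0)"
      unfolding f_def by (auto intro!: tendsto_eq_intros)
    consider "f x 0 < 0" | "f x 0 > 0" | "f x 0 = 0" by linarith
    then show ?thesis
    proof cases
      case 1
      with order_tendstoD(2)[OF lim 1] show ?thesis by simp
    next
      case 2
      from order_tendstoD(1)[OF lim 2] show ?thesis
        by eventually_elim (use 2 in simp)
    \<comment> \<open>Points off the circle keep their sign by continuity. On the circle continuity
      says nothing, but such a lattice point is \<open>p\<close> or \<open>q\<close>, where the
      power does not depend on \<open>t\<close>: it stays on the circle.\<close>
    next
      case 3
      then have "dist c x = r"
        using \<open>r > 0\<close> by (simp add: f_def)
      then have "x \<in> {p, q}"
        using that on by (auto simp: F_def)
      then have "v \<bullet> (x - c) + K = 0"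
        using K by auto
      then show ?thesis
        by (simp add: f_def)
    qed
  qed
  have "finite F"
    unfolding F_def by (rule finite_lattice_points_cball)
  then have "\<forall>\<^sub>F t in at_right 0. \<forall>x\<in>F. f x t < 0 \<longleftrightarrow> f x 0 < 0"
    using sign by (simp add: eventually_ball_finite)
  moreover have "\<forall>\<^sub>F t::real in at_right 0. 0 < t \<and> t < 1"
    by (rule eventually_at_rightI[of 0 1]) auto
  ultimately have "\<forall>\<^sub>F t in at_right 0. (\<forall>x\<in>F. f x t < 0 \<longleftrightarrow> f x 0 < 0) \<and> 0 < t \<and> t < 1"
    by (rule eventually_conj)
  then obtain t where t: "\<forall>x\<in>F. f x t < 0 \<longleftrightarrow> f x 0 < 0" "0 < t" "t < 1"
    using eventually_happens'[OF trivial_limit_at_right_real] by blast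
  have "\<rho> t \<le> \<rho> 1"
    unfolding \<rho>_def using t K(1)
    by (intro real_sqrt_le_mono add_mono mult_right_mono) (auto simp: power_le_one)
  have "x \<in> F" if "x \<in> lattice_points" "x \<in> ball (c + t *\<^sub>R v) (\<rho> t)" for x
  proof -
    have "dist c x \<le> dist c (c + t *\<^sub>R v) + dist (c + t *\<^sub>R v) x"
      by (rule dist_triangle)
    also have "dist c (c + t *\<^sub>R v) \<le> norm v"
      using t by (simp add: dist_norm mult_left_le_one_le)
    finally show ?thesis
      using that \<open>\<rho> t \<le> \<rho> 1\<close> by (simp add: F_def)
  qed
  moreover have "x \<in> F" if "x \<in> lattice_points" "x \<in> ball c r" for x
    using that \<rho>_gr[of 1] norm_ge_zero[of v] unfolding F_def mem_ball mem_cball Int_iff by linarith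
  ultimately have "lattice_points \<inter> ball (c + t *\<^sub>R v) (\<rho> t) = lattice_points \<inter> ball c r"
    using t(1) ball_iff[OF t(2)] ball0_iff by blast
  with \<rho>_gr[OF t(2)] show thesis
    by (rule that)
qed

lemma largest_n_enclosing_imp_lattice_circle:
  assumes "largest_n_enclosing n c r"
  shows "lattice_circle c r"
proof (rule ccontr)
  assume "\<not> lattice_circle c r"
  moreover have r: "r > 0"
    using assms by (simp add: largest_n_enclosing_def n_enclosing_def)
  ultimately have "card (lattice_points \<inter> sphere c r) \<le> 2"
    by (simp add: lattice_circle_def)
  moreover have "finite (lattice_points \<inter> sphere c r)"
    by (rule finite_subset[OF _ finite_lattice_points_cball[of c r]]) auto
  ultimately obtain p q where "lattice_points \<inter> sphere c r \<subseteq> {p, q}"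
    using card_le_2_subset_pair by metis
  with r obtain c' r' where
    "r' > r" "lattice_points \<inter> ball c' r' = lattice_points \<inter> ball c r"
    by (rule exists_larger_enclosing_circle)
  with assms have "n_enclosing n c' r'"
    by (simp add: largest_n_enclosing_def n_enclosing_def)
  with assms \<open>r' > r\<close> show False
    unfolding largest_n_enclosing_def by (meson not_le)
qed

theorem theorem3p1:
  fixes n :: nat
  assumes "MC n"
  shows "\<forall>c r. MC_circle n c r \<longrightarrow> lattice_circle c r"
  using largest_n_enclosing_imp_lattice_circle by (auto simp: MC_circle_def)

end
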